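(* For every $n\geqslant 1$ there is a polynomial $p_n\in\mathbb{Z}[\omega]$ such that $\dim_{\mathbb{K}}(\mathbf{As}_\Omega^2(n))=p_n(|\Omega|)$ for every finite (nonempty) semigroup $(\Omega,\rightarrow)$, and: 1. $p_n$ has degree $2n-2$ and its leading coefficient is $\mathrm{cat}_n=\frac{1}{n}\binom{2n-2}{n-1}$ (so $\mathrm{cat}_1=1,\ \mathrm{cat}_2=1,\ \mathrm{cat}_3=2,\ \mathrm{cat}_4=5,\ldots$). 2. If $n\geqslant 2$, there exists a polynomial $q_n\in\mathbb{Z}[\omega]$ such that $p_n=\omega^nq_n$; moreover, $q_n(0)=(-1)^n$. 3. If $n$ is odd and $n\geqslant 3$, then $p_n\left(\frac{1}{2}\right)=0$.
   Context: $\mathbb{K}$ is a commutative field; operads are operads in $\mathbb{K}$-vector spaces. For a semigroup $(\Omega,\rightarrow)$, $\mathbf{As}_\Omega^2$ is the nonsymmetric operad generated by binary operations $*_{\alpha,\beta}$ (linearly independent, $(\alpha,\beta)\in\Omega^2$) with the relations, for all $\alpha,\beta,\gamma\in\Omega$, $$*_{\alpha\rightarrow\beta,\gamma}\circ_1 *_{\alpha,\beta}=*_{\alpha,\beta\rightarrow\gamma}\circ_2 *_{\beta,\gamma}.$$ The dimension of $\mathbf{As}_\Omega^2(n)$ depends only on $n$ and $\omega=|\Omega|$: the polynomials are determined by $p_1=1$ and $p_n=\omega(\omega-1)\sum_{k=1}^{n-1}p_kp_{n-k}+\omega p_{n-1}$ for $n\geqslant 2$. *)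

theory Defs
  imports
    "Jordan_Normal_Form.VS_Connect"
    "HOL-Algebra.AbelCoset"
    "HOL-Library.Cardinality"
    "HOL-Library.Poly_Mapping"
    "HOL-Library.Tree"
begin


section \<open>The free nonsymmetric operad on binary generators\<close>

text \<open>
  The free nonsymmetric operad on a set \<open>'g\<close> of binary generators has, in arity \<open>n\<close>, a basis
  formed by the planar binary trees with \<open>n\<close> leaves (function \<^const>\<open>size1\<close>) whose internal nodes
  are labelled by generators; \<^const>\<open>Leaf\<close> is the operadic unit. All arities live in the one type
  \<open>'g tree \<Rightarrow>\<^sub>0 'k\<close> of finitely supported linear combinations.
\<close>

definition free_arity :: "nat \<Rightarrow> ('g tree \<Rightarrow>\<^sub>0 'k::field) set" where
  "free_arity n = {f. \<forall>t \<in> Poly_Mapping.keys f. size1 t = n}"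

text \<open>\<open>graft i t u\<close> replaces the \<open>i\<close>-th leaf of \<open>t\<close> by \<open>u\<close>; leaves are counted from the left,
  starting with 1.\<close>

fun graft :: "nat \<Rightarrow> 'g tree \<Rightarrow> 'g tree \<Rightarrow> 'g tree" where
  "graft i Leaf u = u"
| "graft i (Node l a r) u =
     (if i \<le> size1 l then Node (graft i l u) a r else Node l a (graft (i - size1 l) r u))"

text \<open>The partial composition \<open>f \<circ>\<^sub>i g\<close>, meaningful if \<open>f \<in> free_arity n\<close> with \<open>1 \<le> i \<le> n\<close>.\<close>

definition pcomp ::
    "nat \<Rightarrow> ('g tree \<Rightarrow>\<^sub>0 'k::field) \<Rightarrow> ('g tree \<Rightarrow>\<^sub>0 'k) \<Rightarrow> ('g tree \<Rightarrow>\<^sub>0 'k)" where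
  "pcomp i f g =
     (\<Sum>s \<in> Poly_Mapping.keys f. \<Sum>t \<in> Poly_Mapping.keys g.
        Poly_Mapping.single (graft i s t) (Poly_Mapping.lookup f s * Poly_Mapping.lookup g t))"

definition scale :: "'k::field \<Rightarrow> ('g tree \<Rightarrow>\<^sub>0 'k) \<Rightarrow> ('g tree \<Rightarrow>\<^sub>0 'k)" where
  "scale c f = Poly_Mapping.map ((*) c) f"

definition gen :: "'g \<Rightarrow> ('g tree \<Rightarrow>\<^sub>0 'k::field)" where
  "gen a = Poly_Mapping.single (Node Leaf a Leaf) 1"


section \<open>Operads presented by binary generators and relations\<close>

text \<open>\<open>operad_ideal R n f\<close>: \<open>f\<close> lies in the arity \<open>n\<close> component of the operadic ideal generated
  by the (homogeneous) elements of \<open>R\<close>.\<close>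

inductive operad_ideal :: "('g tree \<Rightarrow>\<^sub>0 'k::field) set \<Rightarrow> nat \<Rightarrow> ('g tree \<Rightarrow>\<^sub>0 'k) \<Rightarrow> bool"
  for R :: "('g tree \<Rightarrow>\<^sub>0 'k) set" where
  rel: "f \<in> R \<Longrightarrow> f \<in> free_arity n \<Longrightarrow> operad_ideal R n f"
| zero: "operad_ideal R n 0"
| add: "operad_ideal R n f \<Longrightarrow> operad_ideal R n g \<Longrightarrow> operad_ideal R n (f + g)"
| scale: "operad_ideal R n f \<Longrightarrow> operad_ideal R n (scale c f)"
| comp_left: "operad_ideal R m f \<Longrightarrow> g \<in> free_arity n \<Longrightarrow> 1 \<le> i \<Longrightarrow> i \<le> m
    \<Longrightarrow> operad_ideal R (m + n - 1) (pcomp i f g)"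
| comp_right: "f \<in> free_arity m \<Longrightarrow> operad_ideal R n g \<Longrightarrow> 1 \<le> i \<Longrightarrow> i \<le> m
    \<Longrightarrow> operad_ideal R (m + n - 1) (pcomp i f g)"

text \<open>The multiplicative fields of the underlying ring record play no role in a module.\<close>

definition free_module :: "nat \<Rightarrow> ('k::field, 'g tree \<Rightarrow>\<^sub>0 'k) module" where
  "free_module n =
     \<lparr>carrier = free_arity n, monoid.mult = undefined, one = undefined,
      zero = 0, add = (+), module.smult = scale\<rparr>"

definition quotient_module :: "('a, 'b) module \<Rightarrow> 'b set \<Rightarrow> ('a, 'b set) module" where
  "quotient_module M N =
     \<lparr>carrier = a_rcosets\<^bsub>M\<^esub> N, monoid.mult = undefined, one = undefined,
      zero = N, add = set_add M,
      module.smult = (\<lambda>c X. \<Union>x\<in>X. N +>\<^bsub>M\<^esub> (c \<odot>\<^bsub>M\<^esub> x))\<rparr>"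

definition presented_operad ::
    "('g tree \<Rightarrow>\<^sub>0 'k::field) set \<Rightarrow> nat \<Rightarrow> ('k, ('g tree \<Rightarrow>\<^sub>0 'k) set) module" where
  "presented_operad R n = quotient_module (free_module n) {f. operad_ideal R n f}"


subsection \<open>The components of a presented operad are vector spaces\<close>

lemma lookup_scale [simp]: "Poly_Mapping.lookup (scale c f) t = c * Poly_Mapping.lookup f t"
  by (simp add: scale_def Poly_Mapping.map.rep_eq when_def)

lemma free_arity_iff: "f \<in> free_arity n \<longleftrightarrow> (\<forall>t. size1 t \<noteq> n \<longrightarrow> Poly_Mapping.lookup f t = 0)"
  by (auto simp: free_arity_def in_keys_iff)

lemma module_free: "module class_ring (free_module n :: ('k::field, 'g tree \<Rightarrow>\<^sub>0 'k) module)"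
proof (rule moduleI)
  show "cring (class_ring :: 'k ring)"
    by (rule class_cring.cring_axioms)
  show "abelian_group (free_module n :: ('k::field, 'g tree \<Rightarrow>\<^sub>0 'k) module)"
  proof (rule abelian_groupI)
    fix x :: "'g tree \<Rightarrow>\<^sub>0 'k" assume "x \<in> carrier (free_module n)"
    then show "\<exists>y\<in>carrier (free_module n). y \<oplus>\<^bsub>free_module n\<^esub> x = \<zero>\<^bsub>free_module n\<^esub>"
      by (intro bexI[of _ "- x"]) (auto simp: free_module_def free_arity_iff)
  qed (auto simp: free_module_def free_arity_iff lookup_add add_ac)
qed (auto simp: free_module_def free_arity_iff lookup_add algebra_simps intro!: poly_mapping_eqI)

lemma size1_graft: "1 \<le> i \<Longrightarrow> i \<le> size1 s \<Longrightarrow> size1 (graft i s t) = size1 s + size1 t - 1"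
proof (induction i s t rule: graft.induct)
  case (1 i u)
  then show ?case by simp
next
  case (2 i l a r u)
  then show ?case
    using size1_ge0[of l] size1_ge0[of r] size1_ge0[of u] by (auto simp del: size1_ge0)
qed

lemma free_arity_zero: "0 \<in> free_arity n"
  by (simp add: free_arity_iff)

lemma free_arity_add: "f \<in> free_arity n \<Longrightarrow> g \<in> free_arity n \<Longrightarrow> f + g \<in> free_arity n"
  by (simp add: free_arity_iff lookup_add)

lemma free_arity_sum: "(\<And>x. x \<in> A \<Longrightarrow> h x \<in> free_arity n) \<Longrightarrow> sum h A \<in> free_arity n"
  by (induction A rule: infinite_finite_induct) (auto intro: free_arity_zero free_arity_add)

lemma pcomp_free_arity:
  assumes "f \<in> free_arity m" "g \<in> free_arity n" "1 \<le> i" "i \<le> m"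
  shows "pcomp i f g \<in> free_arity (m + n - 1)"
proof -
  have "Poly_Mapping.single (graft i s t) c \<in> free_arity (m + n - 1)"
    if "s \<in> Poly_Mapping.keys f" "t \<in> Poly_Mapping.keys g" for s t c
    using that assms by (auto simp: free_arity_def size1_graft)
  then show ?thesis
    unfolding pcomp_def by (intro free_arity_sum)
qed

lemma free_arity_scale: "f \<in> free_arity n \<Longrightarrow> scale c f \<in> free_arity n"
  by (simp add: free_arity_iff)

lemma operad_ideal_free_arity: "operad_ideal R n f \<Longrightarrow> f \<in> free_arity n"
  by (induction rule: operad_ideal.induct)
    (auto intro: pcomp_free_arity free_arity_add free_arity_zero free_arity_scale simp del: One_nat_def)

lemma submodule_operad_ideal:
  "submodule class_ring {f. operad_ideal R n f} (free_module n :: ('k::field, 'g tree \<Rightarrow>\<^sub>0 'k) module)"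
  by (intro submodule.intro module_free)
     (auto simp: free_module_def dest: operad_ideal_free_arity intro: operad_ideal.intros)

lemma module_quotient:
  fixes R (structure) and M (structure)
  assumes "submodule R N M"
  shows "module R (quotient_module M N)"
proof -
  interpret S: submodule R N M by fact
  interpret M: Module.module R M by (rule S.module)
  have minv: "\<ominus>\<^bsub>M\<^esub> v \<in> N" if "v \<in> N" for v
  proof -
    have "\<ominus>\<^bsub>M\<^esub> v = (\<ominus>\<^bsub>R\<^esub> \<one>\<^bsub>R\<^esub>) \<odot>\<^bsub>M\<^esub> v"
      using that S.subset by (metis M.R.one_closed M.smult_l_minus M.smult_one subsetD)
    then show ?thesis using that by simp
  qed
  have "subgroup N (add_monoid M)"
    by (rule subgroup.intro) (use S.subset minv in \<open>auto simp flip: a_inv_def\<close>)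
  then interpret A: abelian_subgroup N M
    by (intro abelian_subgroupI3) (auto simp: additive_subgroup_def M.abelian_group_axioms)
  let ?Q = "quotient_module M N"
  have car: "carrier ?Q = a_rcosets\<^bsub>M\<^esub> N" "zero ?Q = N" "add ?Q = set_add M"
    by (simp_all add: quotient_module_def)
  have cl: "N +>\<^bsub>M\<^esub> x \<in> a_rcosets\<^bsub>M\<^esub> N" if "x \<in> carrier M" for x
    using that by (auto simp: A_RCOSETS_def')
  have exE: "\<exists>x\<in>carrier M. X = N +>\<^bsub>M\<^esub> x" if "X \<in> a_rcosets\<^bsub>M\<^esub> N" for X
    using that by (auto simp: A_RCOSETS_def')
  have N0: "N +>\<^bsub>M\<^esub> \<zero>\<^bsub>M\<^esub> = N"
    using S.subset by (rule M.a_coset_add_zero)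
  have smul: "module.smult ?Q c (N +>\<^bsub>M\<^esub> x) = N +>\<^bsub>M\<^esub> (c \<odot>\<^bsub>M\<^esub> x)"
    if c: "c \<in> carrier R" and x: "x \<in> carrier M" for c x
  proof -
    have "N +>\<^bsub>M\<^esub> (c \<odot>\<^bsub>M\<^esub> y) = N +>\<^bsub>M\<^esub> (c \<odot>\<^bsub>M\<^esub> x)" if "y \<in> N +>\<^bsub>M\<^esub> x" for y
    proof -
      from that obtain v where v: "v \<in> N" "y = v \<oplus>\<^bsub>M\<^esub> x"
        by (auto simp: a_r_coset_def')
      have "c \<odot>\<^bsub>M\<^esub> y = c \<odot>\<^bsub>M\<^esub> v \<oplus>\<^bsub>M\<^esub> c \<odot>\<^bsub>M\<^esub> x"
        using v c x S.subset by (auto intro: M.smult_r_distr)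
      moreover have "c \<odot>\<^bsub>M\<^esub> v \<in> N" using v c by simp
      ultimately have "c \<odot>\<^bsub>M\<^esub> y \<in> N +>\<^bsub>M\<^esub> (c \<odot>\<^bsub>M\<^esub> x)"
        by (auto simp: a_r_coset_def')
      then show ?thesis
        using A.a_repr_independence'[of "c \<odot>\<^bsub>M\<^esub> y" "c \<odot>\<^bsub>M\<^esub> x"] c x by simp
    qed
    moreover have "N +>\<^bsub>M\<^esub> x \<noteq> {}" using A.a_rcos_self[OF x] by blast
    ultimately show ?thesis by (auto simp: quotient_module_def)
  qed
  show ?thesis
  proof (rule moduleI)
    show "cring R" by (rule M.R.cring_axioms)
    show "abelian_group ?Q"
    proof (rule abelian_groupI)
      fix X assume "X \<in> carrier ?Q"
      then obtain x where x: "x \<in> carrier M" "X = N +>\<^bsub>M\<^esub> x" using exE car by metis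
      then show "\<exists>Y\<in>carrier ?Q. Y \<oplus>\<^bsub>?Q\<^esub> X = \<zero>\<^bsub>?Q\<^esub>"
        by (intro bexI[of _ "N +>\<^bsub>M\<^esub> (\<ominus>\<^bsub>M\<^esub> x)"])
           (auto simp: car cl A.a_rcos_sum M.l_neg N0)
    qed (auto simp: car dest!: exE simp: A.a_rcos_sum cl M.a_ac A.a_subgroup_in_rcosets A.rcosets_add_eq A.a_setmult_closed)
  qed (auto simp: car dest!: exE simp: A.a_rcos_sum cl smul M.smult_l_distr M.smult_r_distr M.smult_assoc1)
qed

lemma vectorspace_presented_operad:
  "vectorspace class_ring (presented_operad R n)"
  unfolding presented_operad_def
  by (intro vectorspace.intro module_quotient submodule_operad_ideal class_field.field_axioms)


section \<open>The operad \<open>As\<^sup>2\<^sub>\<Omega>\<close>\<close>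

text \<open>The semigroup \<open>\<Omega>\<close> is a type \<open>'w\<close> with an operation \<open>arr\<close> (the arrow); the generator
  \<open>*\<^bsub>\<alpha>,\<beta>\<^esub>\<close> is \<open>gen (\<alpha>, \<beta>)\<close>.\<close>

definition As2_relations :: "('w \<Rightarrow> 'w \<Rightarrow> 'w) \<Rightarrow> (('w \<times> 'w) tree \<Rightarrow>\<^sub>0 'k::field) set" where
  "As2_relations arr =
     {pcomp 1 (gen (arr \<alpha> \<beta>, \<gamma>)) (gen (\<alpha>, \<beta>)) - pcomp 2 (gen (\<alpha>, arr \<beta> \<gamma>)) (gen (\<beta>, \<gamma>))
      | \<alpha> \<beta> \<gamma>. True}"

definition As2 ::
    "('w \<Rightarrow> 'w \<Rightarrow> 'w) \<Rightarrow> nat \<Rightarrow> ('k::field, (('w \<times> 'w) tree \<Rightarrow>\<^sub>0 'k) set) module" where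
  "As2 arr n = presented_operad (As2_relations arr) n"


section \<open>The dimension polynomials\<close>

text \<open>The indeterminate \<open>\<omega>\<close> is \<open>[:0, 1:]\<close>; the value at index 0 is a dummy.\<close>

fun As2_poly :: "nat \<Rightarrow> int poly" where
  "As2_poly n =
     (if n = 0 then 0
      else if n = 1 then 1
      else [:0, 1:] * ([:0, 1:] - 1) * (\<Sum>k = 1..n - 1. As2_poly k * As2_poly (n - k))
           + [:0, 1:] * As2_poly (n - 1))"

declare As2_poly.simps [simp del]

end

theory Submission
  imports Defs "HOL-Computational_Algebra.Formal_Power_Series" "Jordan_Normal_Form.Char_Poly"
begin

text \<open>
  Reading each relation as a rewrite rule from its left to its right hand side gives a terminating
  rewriting system on trees, whose only critical pair is confluent by associativity of the arrow.
  Each relation is a difference of two trees: every tree is congruent to its normal form, and a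
  linear functional that only depends on the normal form of trees vanishes on the operadic ideal.
  So the trees in normal form represent a basis of \<open>As\<^sup>2\<^sub>\<Omega>(n)\<close>. A tree is normal iff both its subtrees are and the root does not form a redex with its
  left child \<open>(\<alpha>, \<beta>)\<close>, which excludes \<open>|\<Omega>|\<close> of the \<open>|\<Omega>|\<^sup>2\<close> labels of the root; this is the
  recursion of \<open>p\<^sub>n\<close>. The statements on \<open>p\<^sub>n\<close> follow from the recursion, that for the leading
  coefficient through the generating series of the Catalan numbers.
\<close>

section \<open>Normal forms\<close>

text \<open>Failure means that a root labelled \<open>b\<close> over the left subtree
  \<open>l\<close> is a redex. Only \<open>fst b\<close> enters, so admissibility survives a
  rotation that changes the second component of the root label.\<close>

fun admissible :: "('w \<Rightarrow> 'w \<Rightarrow> 'w) \<Rightarrow> ('w \<times> 'w) tree \<Rightarrow> 'w \<times> 'w \<Rightarrow> bool" where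
  "admissible arr Leaf b = True"
| "admissible arr (Node l a m) b = (arr (fst a) (snd a) \<noteq> fst b)"

fun normal_tree :: "('w \<Rightarrow> 'w \<Rightarrow> 'w) \<Rightarrow> ('w \<times> 'w) tree \<Rightarrow> bool" where
  "normal_tree arr Leaf = True"
| "normal_tree arr (Node l a r) = (normal_tree arr l \<and> normal_tree arr r \<and> admissible arr l a)"

text \<open>Intended for normal \<open>l\<close> and \<open>r\<close>. A rotation gives the new root
  the first component of the old left child's label, so the root is no longer a redex and only the
  new right child can be one. The recursion therefore runs down the right spine of the left
  subtree.\<close>

fun nf_node ::
    "('w \<Rightarrow> 'w \<Rightarrow> 'w) \<Rightarrow> ('w \<times> 'w) tree \<Rightarrow> 'w \<times> 'w \<Rightarrow> ('w \<times> 'w) tree \<Rightarrow> ('w \<times> 'w) tree" where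
  "nf_node arr Leaf b r = Node Leaf b r"
| "nf_node arr (Node l a m) b r =
     (if arr (fst a) (snd a) = fst b
      then Node l (fst a, arr (snd a) (snd b)) (nf_node arr m (snd a, snd b) r)
      else Node (Node l a m) b r)"

fun nf :: "('w \<Rightarrow> 'w \<Rightarrow> 'w) \<Rightarrow> ('w \<times> 'w) tree \<Rightarrow> ('w \<times> 'w) tree" where
  "nf arr Leaf = Leaf"
| "nf arr (Node l a r) = nf_node arr (nf arr l) a (nf arr r)"

inductive rewr :: "('w \<Rightarrow> 'w \<Rightarrow> 'w) \<Rightarrow> ('w \<times> 'w) tree \<Rightarrow> ('w \<times> 'w) tree \<Rightarrow> bool" for arr where
  rotate: "rewr arr (Node (Node l (\<alpha>, \<beta>) m) (arr \<alpha> \<beta>, \<gamma>) r)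
                    (Node l (\<alpha>, arr \<beta> \<gamma>) (Node m (\<beta>, \<gamma>) r))"
| left: "rewr arr l l' \<Longrightarrow> rewr arr (Node l a r) (Node l' a r)"
| right: "rewr arr r r' \<Longrightarrow> rewr arr (Node l a r) (Node l a r')"

lemma admissible_cong: "fst b = fst c \<Longrightarrow> admissible arr l b = admissible arr l c"
  by (cases l) auto

lemma normal_tree_nf_node:
  "normal_tree arr l \<Longrightarrow> normal_tree arr r \<Longrightarrow> normal_tree arr (nf_node arr l b r)"
  by (induction arr l b r rule: nf_node.induct) (auto cong: admissible_cong)

lemma normal_tree_nf: "normal_tree arr (nf arr t)"
  by (induction t) (auto intro: normal_tree_nf_node)

lemma nf_node_admissible: "admissible arr l b \<Longrightarrow> nf_node arr l b r = Node l b r"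
  by (cases l) auto

lemma nf_normal_tree: "normal_tree arr t \<Longrightarrow> nf arr t = t"
  by (induction t) (auto simp: nf_node_admissible)

text \<open>The confluence of the only critical pair.\<close>

lemma nf_node_rotate:
  assumes "semigroup arr"
  shows "normal_tree arr l \<Longrightarrow> nf_node arr (nf_node arr l (\<alpha>, \<beta>) m) (arr \<alpha> \<beta>, \<gamma>) r
       = nf_node arr l (\<alpha>, arr \<beta> \<gamma>) (nf_node arr m (\<beta>, \<gamma>) r)"
proof (induction l arbitrary: \<alpha> \<beta> \<gamma> m r)
  case Leaf
  then show ?case by simp
next
  \<comment> \<open>If \<open>c\<close> forms a redex with \<open>\<alpha>\<close>, associativity
    makes the second rotation applicable at the root again and makes the root labels agree; the
    induction hypothesis for \<open>k\<close> joins the right subtrees. Otherwise both sides keep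
    \<open>Node l c k\<close> as left child.\<close>
  case (Node l c k)
  then show ?case
    using semigroup.assoc[OF assms] by (cases c) auto
qed

text \<open>The normal form of a node depends only on those of its subtrees, so steps below the root
  are immediate and a rotation at the root is the confluence computation.\<close>

lemma nf_rewr:
  assumes "semigroup arr" "rewr arr s t"
  shows "nf arr s = nf arr t"
  using assms(2) by induction (auto simp: nf_node_rotate[OF assms(1)] normal_tree_nf)

section \<open>Rewriting paths and their compatibility with grafting\<close>

lemma rewr_size1: "rewr arr s t \<Longrightarrow> size1 s = size1 t"
  by (induction rule: rewr.induct) auto

lemma rewr_rtranclp_Node:
  assumes "(rewr arr)\<^sup>*\<^sup>* l l'" "(rewr arr)\<^sup>*\<^sup>* r r'"
  shows "(rewr arr)\<^sup>*\<^sup>* (Node l a r) (Node l' a r')"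
proof -
  have "(rewr arr)\<^sup>*\<^sup>* (Node l a r) (Node l' a r)"
    using assms(1) by induction (auto intro: rtranclp.rtrancl_into_rtrancl rewr.left)
  also have "(rewr arr)\<^sup>*\<^sup>* (Node l' a r) (Node l' a r')"
    using assms(2) by induction (auto intro: rtranclp.rtrancl_into_rtrancl rewr.right)
  finally show ?thesis .
qed

lemma rewr_nf_node: "(rewr arr)\<^sup>*\<^sup>* (Node l b r) (nf_node arr l b r)"
proof (induction arr l b r rule: nf_node.induct)
  case (2 arr l a m b r)
  show ?case
  proof (cases "arr (fst a) (snd a) = fst b")
    case True
    then have "rewr arr (Node (Node l a m) b r)
        (Node l (fst a, arr (snd a) (snd b)) (Node m (snd a, snd b) r))"
      using rewr.rotate[of arr l "fst a" "snd a" m "snd b" r] by simp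
    also have "(rewr arr)\<^sup>*\<^sup>* \<dots>
        (Node l (fst a, arr (snd a) (snd b)) (nf_node arr m (snd a, snd b) r))"
      by (intro rewr_rtranclp_Node 2 True) auto
    finally show ?thesis using True by simp
  qed simp
qed simp

text \<open>Normalisation is realised by finitely many single steps, so whatever holds for each step
  carries over to \<open>nf\<close>.\<close>

lemma rewr_nf: "(rewr arr)\<^sup>*\<^sup>* t (nf arr t)"
  by (induction t) (auto intro: rtranclp_trans[OF rewr_rtranclp_Node rewr_nf_node])

text \<open>A rotation keeps the left-to-right order of \<open>l\<close>, \<open>m\<close>,
  \<open>r\<close> and their sizes, so the \<open>i\<close>-th leaf lies in the same one of them
  before and after the step.\<close>

lemma rewr_graft_left: "rewr arr s s' \<Longrightarrow> rewr arr (graft i s t) (graft i s' t)"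
proof (induction arbitrary: i rule: rewr.induct)
  case (rotate l \<alpha> \<beta> m \<gamma> r)
  then show ?case
    by (auto intro: rewr.intros simp: diff_diff_left add_ac not_le)
next
  case (left l l' a r)
  then show ?case using rewr_size1[OF left.hyps] by (auto intro: rewr.intros)
next
  case (right r r' l a)
  then show ?case by (auto intro: rewr.intros)
qed

lemma rewr_graft_right: "rewr arr t t' \<Longrightarrow> rewr arr (graft i s t) (graft i s t')"
  by (induction i s t rule: graft.induct) (auto intro: rewr.intros)

lemma nf_rewr_rtranclp:
  assumes "semigroup arr" "(rewr arr)\<^sup>*\<^sup>* s t"
  shows "nf arr s = nf arr t"
  using assms(2) by induction (auto simp: nf_rewr[OF assms(1)])

text \<open>Together with \<open>nf_graft_right\<close>: precomposing an \<open>nf\<close>-invariant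
  function with a graft gives an \<open>nf\<close>-invariant function again, as the composition
  cases of the ideal require.\<close>

lemma nf_graft_left:
  assumes "semigroup arr"
  shows "nf arr (graft i (nf arr s) t) = nf arr (graft i s t)"
proof -
  have "(rewr arr)\<^sup>*\<^sup>* (graft i s t) (graft i (nf arr s) t)"
    using rewr_nf[of arr s]
    by induction (auto intro: rtranclp.rtrancl_into_rtrancl rewr_graft_left)
  then show ?thesis using nf_rewr_rtranclp[OF assms] by metis
qed

lemma nf_graft_right:
  assumes "semigroup arr"
  shows "nf arr (graft i s (nf arr t)) = nf arr (graft i s t)"
proof -
  have "(rewr arr)\<^sup>*\<^sup>* (graft i s t) (graft i s (nf arr t))"
    using rewr_nf[of arr t]
    by induction (auto intro: rtranclp.rtrancl_into_rtrancl rewr_graft_right)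
  then show ?thesis using nf_rewr_rtranclp[OF assms] by metis
qed

section \<open>Counting normal forms\<close>

lemma As2_poly_0: "As2_poly 0 = 0"
  by (simp add: As2_poly.simps)

lemma As2_poly_1: "As2_poly (Suc 0) = 1"
  by (simp add: As2_poly.simps)

lemma As2_poly_rec:
  "n \<ge> 2 \<Longrightarrow> As2_poly n =
     [:0, 1:] * ([:0, 1:] - 1) * (\<Sum>k = 1..n - 1. As2_poly k * As2_poly (n - k))
     + [:0, 1:] * As2_poly (n - 1)"
  by (subst As2_poly.simps) simp

definition normal_trees :: "('w \<Rightarrow> 'w \<Rightarrow> 'w) \<Rightarrow> nat \<Rightarrow> ('w \<times> 'w) tree set" where
  "normal_trees arr n = {t. normal_tree arr t \<and> size1 t = n}"

lemma rewr_rtranclp_size1: "(rewr arr)\<^sup>*\<^sup>* s t \<Longrightarrow> size1 s = size1 t"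
  by (induction rule: rtranclp.induct) (auto dest: rewr_size1)

lemma normal_trees_0: "normal_trees arr 0 = {}"
  by (simp add: normal_trees_def)

lemma normal_trees_1: "normal_trees arr (Suc 0) = {Leaf}"
proof -
  have "t = Leaf" if "size1 t = Suc 0" for t :: "('w \<times> 'w) tree"
    using that by (cases t) (auto simp: size1_size)
  then show ?thesis by (auto simp: normal_trees_def)
qed

text \<open>Decomposition at the root by the arity \<open>k\<close> of the left subtree. The left
  subtree comes first in the dependent product because the set of allowed labels depends on
  it.\<close>

lemma normal_trees_rec:
  assumes "n \<ge> 2"
  shows "normal_trees arr n = (\<Union>k\<in>{1..n - 1}. (\<lambda>(l, r, a). Node l a r) `
    (SIGMA l:normal_trees arr k. normal_trees arr (n - k) \<times> {a. admissible arr l a}))"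
    (is "_ = ?R")
proof (intro Set.set_eqI iffI)
  fix t assume "t \<in> normal_trees arr n"
  then obtain l a r where "t = Node l a r" "normal_tree arr l" "normal_tree arr r" "admissible arr l a"
      "size1 l + size1 r = n"
    using assms by (cases t) (auto simp: normal_trees_def)
  moreover have "size1 l \<ge> 1" "size1 r \<ge> 1"
    using size1_ge0[of l] size1_ge0[of r] by linarith+
  ultimately show "t \<in> ?R"
    by (intro UN_I[of "size1 l"]) (auto simp: normal_trees_def image_iff)
qed (auto simp: normal_trees_def)

lemma card_admissible:
  "int (card {a. admissible arr (l :: ('w::finite \<times> 'w) tree) a})
     = (if l = Leaf then int CARD('w) ^ 2 else int CARD('w) * (int CARD('w) - 1))"
proof (cases l)
  case Leaf
  then show ?thesis by (simp add: power2_eq_square)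
next
  case (Node l' b m)
  then have "{a. admissible arr l a} = (UNIV - {arr (fst b) (snd b)}) \<times> UNIV"
    by auto
  moreover have "CARD('w) \<ge> 1"
    using zero_less_card_finite[where 'a='w] by linarith
  ultimately show ?thesis
    using Node by (simp add: card_cartesian_product card_Diff_singleton of_nat_diff)
qed

lemma finite_normal_trees: "finite (normal_trees arr n :: ('w::finite \<times> 'w) tree set)"
proof (induction n rule: less_induct)
  case (less n)
  show ?case
  proof (cases "n \<ge> 2")
    case True
    show ?thesis
      unfolding normal_trees_rec[OF True]
      by (intro finite_UN_I finite_imageI finite_SigmaI less) (use True in auto)
  next
    case False
    then have "n = 0 \<or> n = Suc 0" by linarith
    then show ?thesis by (auto simp: normal_trees_0 normal_trees_1)
  qed
qed

lemma card_normal_trees_rec: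
  fixes arr :: "'w::finite \<Rightarrow> 'w \<Rightarrow> 'w"
  defines "N \<equiv> \<lambda>n. int (card (normal_trees arr n))" and "\<omega> \<equiv> int CARD('w)"
  assumes "n \<ge> 2"
  shows "N n = \<omega> * (\<omega> - 1) * (\<Sum>k = 1..n - 1. N k * N (n - k)) + \<omega> * N (n - 1)"
proof -
  define S where "S k = (SIGMA l:normal_trees arr k. normal_trees arr (n - k) \<times> {a. admissible arr l a})" for k
  have inj: "inj_on (\<lambda>(l, r, a). Node l a r) (S k)" for k
    by (auto simp: inj_on_def)
  have fin: "finite (S k)" for k
    unfolding S_def by (intro finite_SigmaI finite_normal_trees) (auto intro: finite_normal_trees)
  have card_adm: "int (card {a. admissible arr l a}) =
      (if l = Leaf then \<omega> ^ 2 else \<omega> * (\<omega> - 1))" for l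
    unfolding \<omega>_def by (rule card_admissible)
  \<comment> \<open>The left subtree is a leaf only for \<open>k = 1\<close>. There the surplus of
    \<omega>^2 over \<omega>(\<omega> - 1) is \<omega>, which produces the linear term of the
    recursion.\<close>
  have card_S: "int (card (S k)) = \<omega> * (\<omega> - 1) * (N k * N (n - k))
      + (if k = 1 then \<omega> * N (n - 1) else 0)" for k
  proof -
    have "int (card (S k)) = (\<Sum>l\<in>normal_trees arr k. N (n - k) *
        (if l = Leaf then \<omega> ^ 2 else \<omega> * (\<omega> - 1)))"
      unfolding S_def
      by (subst card_SigmaI)
         (simp_all add: finite_normal_trees card_cartesian_product card_adm N_def)
    also have "\<dots> = (\<Sum>l\<in>normal_trees arr k. N (n - k) * (\<omega> * (\<omega> - 1)) +
        (if l = Leaf then N (n - k) * \<omega> else 0))"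
      by (intro sum.cong) (auto simp: algebra_simps power2_eq_square)
    also have "\<dots> = \<omega> * (\<omega> - 1) * (N k * N (n - k)) + (if k = 1 then \<omega> * N (n - 1) else 0)"
      by (auto simp: sum.distrib finite_normal_trees sum.delta N_def normal_trees_1)
         (auto simp: normal_trees_def)
    finally show ?thesis .
  qed
  have "normal_trees arr n = (\<Union>k\<in>{1..n - 1}. (\<lambda>(l, r, a). Node l a r) ` S k)"
    unfolding S_def by (rule normal_trees_rec) fact
  also have "card \<dots> = (\<Sum>k = 1..n - 1. card ((\<lambda>(l, r, a). Node l a r) ` S k))"
  proof (rule card_UN_disjoint)
    show "\<forall>i\<in>{1..n - 1}. \<forall>j\<in>{1..n - 1}. i \<noteq> j \<longrightarrow>
        (\<lambda>(l, r, a). Node l a r) ` S i \<inter> (\<lambda>(l, r, a). Node l a r) ` S j = {}"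
      by (auto simp: S_def normal_trees_def)
  qed (auto simp: fin)
  also have "\<dots> = (\<Sum>k = 1..n - 1. card (S k))"
    by (simp add: card_image[OF inj])
  finally have "N n = (\<Sum>k = 1..n - 1. \<omega> * (\<omega> - 1) * (N k * N (n - k))
      + (if k = 1 then \<omega> * N (n - 1) else 0))"
    unfolding N_def by (simp only: of_nat_sum card_S[unfolded N_def])
  then show ?thesis
    using assms(3) by (simp add: sum.distrib sum_distrib_left sum.delta)
qed

lemma card_normal_trees:
  fixes arr :: "'w::finite \<Rightarrow> 'w \<Rightarrow> 'w"
  shows "int (card (normal_trees arr n)) = poly (As2_poly n) (int CARD('w))"
proof (induction n rule: less_induct)
  case (less n)
  show ?case
  proof (cases "n \<ge> 2")
    case True
    have "(\<Sum>k = 1..n - 1. int (card (normal_trees arr k)) * int (card (normal_trees arr (n - k))))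
        = (\<Sum>k = 1..n - 1. poly (As2_poly k) (int CARD('w)) * poly (As2_poly (n - k)) (int CARD('w)))"
      using True by (intro sum.cong) (auto simp: less)
    with True less[of "n - 1"] show ?thesis
      by (subst card_normal_trees_rec[OF True], subst As2_poly_rec[OF True])
         (simp add: poly_sum algebra_simps)
  next
    case False
    then have "n = 0 \<or> n = Suc 0" by linarith
    then show ?thesis
      by (auto simp: normal_trees_0 normal_trees_1 As2_poly_0 As2_poly_1)
  qed
qed

section \<open>The ideal of relations\<close>

definition linear_ext :: "('g tree \<Rightarrow> 'k) \<Rightarrow> ('g tree \<Rightarrow>\<^sub>0 'k::field) \<Rightarrow> 'k" where
  "linear_ext h f = (\<Sum>t\<in>Poly_Mapping.keys f. Poly_Mapping.lookup f t * h t)"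

lemma linear_ext_superset:
  assumes "finite A" "Poly_Mapping.keys f \<subseteq> A"
  shows "linear_ext h f = (\<Sum>t\<in>A. Poly_Mapping.lookup f t * h t)"
  unfolding linear_ext_def
  by (intro sum.mono_neutral_left assms) (auto simp: in_keys_iff)

lemma linear_ext_zero: "linear_ext h 0 = 0"
  by (simp add: linear_ext_def)

lemma linear_ext_add: "linear_ext h (f + g) = linear_ext h f + linear_ext h g"
proof -
  let ?A = "Poly_Mapping.keys f \<union> Poly_Mapping.keys g"
  have "linear_ext h (f + g) = (\<Sum>t\<in>?A. Poly_Mapping.lookup (f + g) t * h t)"
    by (intro linear_ext_superset keys_add) auto
  also have "\<dots> = linear_ext h f + linear_ext h g"
    by (simp add: linear_ext_superset[of ?A] lookup_add ring_distribs sum.distrib)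
  finally show ?thesis .
qed

lemma linear_ext_scale: "linear_ext h (scale c f) = c * linear_ext h f"
proof -
  have "linear_ext h (scale c f) = (\<Sum>t\<in>Poly_Mapping.keys f. Poly_Mapping.lookup (scale c f) t * h t)"
    by (intro linear_ext_superset) (auto simp: in_keys_iff)
  then show ?thesis
    by (simp add: linear_ext_def sum_distrib_left mult.assoc)
qed

lemma linear_ext_diff: "linear_ext h (f - g) = linear_ext h f - linear_ext h g"
  using linear_ext_add[of h "f - g" g] by simp

lemma linear_ext_single: "linear_ext h (Poly_Mapping.single t c) = c * h t"
  by (simp add: linear_ext_def)

lemma linear_ext_sum: "linear_ext h (sum F A) = (\<Sum>x\<in>A. linear_ext h (F x))"
  by (induction A rule: infinite_finite_induct) (auto simp: linear_ext_zero linear_ext_add)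

lemma linear_ext_pcomp: "linear_ext h (pcomp i f g) = linear_ext (\<lambda>s. linear_ext (\<lambda>t. h (graft i s t)) g) f"
  unfolding pcomp_def linear_ext_sum linear_ext_single
  by (simp add: linear_ext_def sum_distrib_left mult.assoc)

text \<open>The summations are exchanged so that the outer functional acts on the right factor, the
  one in the ideal in the case \<open>comp_right\<close>.\<close>

lemma linear_ext_pcomp': "linear_ext h (pcomp i f g) = linear_ext (\<lambda>t. linear_ext (\<lambda>s. h (graft i s t)) f) g"
  unfolding linear_ext_pcomp unfolding linear_ext_def sum_distrib_left
  by (subst sum.swap) (simp add: mult_ac)

lemma pcomp_single:
  "pcomp i (Poly_Mapping.single s c) (Poly_Mapping.single t d)
     = Poly_Mapping.single (graft i s t) (c * d)"
  by (simp add: pcomp_def)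

text \<open>Coefficients are themselves linear extensions, so additivity of \<open>pcomp\<close> in
  each argument can be read off from that of \<open>linear_ext\<close>.\<close>

lemma lookup_eq_linear_ext: "Poly_Mapping.lookup f u = linear_ext (\<lambda>t. if t = u then 1 else 0) f"
proof -
  have "linear_ext (\<lambda>t. if t = u then 1 else 0) f
      = (\<Sum>t\<in>Poly_Mapping.keys f. if t = u then Poly_Mapping.lookup f t else 0)"
    unfolding linear_ext_def by (intro sum.cong) auto
  then show ?thesis by (simp add: in_keys_iff)
qed

lemma pcomp_diff_left: "pcomp i (f - g) h = pcomp i f h - pcomp i g h"
  by (intro poly_mapping_eqI) (simp only: lookup_eq_linear_ext linear_ext_pcomp linear_ext_diff)

lemma pcomp_diff_right: "pcomp i f (g - h) = pcomp i f g - pcomp i f h"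
  by (intro poly_mapping_eqI) (simp only: lookup_eq_linear_ext linear_ext_pcomp' linear_ext_diff)

text \<open>On a generating relation both trees have the same normal form, so the two values of
  \<open>h\<close> cancel. For a composition, \<open>h\<close> after grafting is again
  \<open>nf\<close>-invariant in the ideal factor; this is why the induction must generalise over
  \<open>h\<close>.\<close>

lemma ideal_linear_ext:
  fixes f :: "('w \<times> 'w) tree \<Rightarrow>\<^sub>0 'k::field"
  assumes arr: "semigroup arr"
    and "operad_ideal (As2_relations arr) n f" "\<And>t. h (nf arr t) = h t"
  shows "linear_ext h f = 0"
  using assms(2,3)
proof (induction arbitrary: h rule: operad_ideal.induct)
  case (rel f n)
  then obtain \<alpha> \<beta> \<gamma> where "f = pcomp 1 (gen (arr \<alpha> \<beta>, \<gamma>)) (gen (\<alpha>, \<beta>))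
      - pcomp 2 (gen (\<alpha>, arr \<beta> \<gamma>)) (gen (\<beta>, \<gamma>))"
    by (auto simp: As2_relations_def)
  then have "linear_ext h f = h (Node (Node Leaf (\<alpha>, \<beta>) Leaf) (arr \<alpha> \<beta>, \<gamma>) Leaf)
      - h (Node Leaf (\<alpha>, arr \<beta> \<gamma>) (Node Leaf (\<beta>, \<gamma>) Leaf))"
    by (simp add: gen_def pcomp_single linear_ext_diff linear_ext_single)
  moreover have "nf arr (Node (Node Leaf (\<alpha>, \<beta>) Leaf) (arr \<alpha> \<beta>, \<gamma>) Leaf)
      = nf arr (Node Leaf (\<alpha>, arr \<beta> \<gamma>) (Node Leaf (\<beta>, \<gamma>) Leaf))"
    by (rule nf_rewr[OF arr rewr.rotate])
  ultimately show ?case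
    using rel.prems by (metis cancel_comm_monoid_add_class.diff_cancel)
next
  case (comp_left m f g n i)
  have "h (graft i (nf arr s) t) = h (graft i s t)" for s t
    using comp_left.prems nf_graft_left[OF arr] by metis
  then show ?case
    unfolding linear_ext_pcomp by (intro comp_left.IH) simp
next
  case (comp_right f m n g i)
  have "h (graft i s (nf arr t)) = h (graft i s t)" for s t
    using comp_right.prems nf_graft_right[OF arr] by metis
  then show ?case
    unfolding linear_ext_pcomp' by (intro comp_right.IH) simp
qed (auto simp: linear_ext_zero linear_ext_add linear_ext_scale)

section \<open>Normal trees modulo the ideal\<close>

lemma operad_ideal_diff:
  assumes "operad_ideal R n f" "operad_ideal R n g"
  shows "operad_ideal R n (f - g)"
proof -
  have "f - g = f + scale (- 1) g"
    by (intro poly_mapping_eqI) (simp add: lookup_add lookup_minus)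
  then show ?thesis
    using operad_ideal.add[OF assms(1) operad_ideal.scale[OF assms(2)], of "- 1"] by (simp only:)
qed

lemma single_free_arity: "size1 t = n \<Longrightarrow> Poly_Mapping.single t c \<in> free_arity n"
  by (simp add: free_arity_def)

lemma ideal_graft_left:
  assumes "operad_ideal R m (Poly_Mapping.single s 1 - Poly_Mapping.single s' 1)"
    "1 \<le> i" "i \<le> m"
  shows "operad_ideal R (m + size1 t - 1)
    (Poly_Mapping.single (graft i s t) 1 - Poly_Mapping.single (graft i s' t) 1)"
  using operad_ideal.comp_left[OF assms(1) single_free_arity[OF refl] assms(2,3), of t 1]
  by (simp add: pcomp_diff_left pcomp_single)

lemma ideal_graft_right:
  assumes "operad_ideal R m (Poly_Mapping.single s 1 - Poly_Mapping.single s' 1)"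
    "1 \<le> i" "i \<le> size1 t"
  shows "operad_ideal R (size1 t + m - 1)
    (Poly_Mapping.single (graft i t s) 1 - Poly_Mapping.single (graft i t s') 1)"
  using operad_ideal.comp_right[OF single_free_arity[OF refl] assms(1,2,3), of 1]
  by (simp add: pcomp_diff_right pcomp_single)

text \<open>A step is a relation inserted into a context: left composition fills the three leaves of
  the relation with \<open>l\<close>, \<open>m\<close>, \<open>r\<close>, and right composition
  places the result inside the surrounding tree.\<close>

lemma rewr_ideal:
  "rewr arr s t \<Longrightarrow> operad_ideal (As2_relations arr) (size1 s)
     (Poly_Mapping.single s 1 - Poly_Mapping.single t (1 :: 'k::field))"
proof (induction rule: rewr.induct)
  case (rotate l \<alpha> \<beta> m \<gamma> r)
  define s where "s = Node (Node Leaf (\<alpha>, \<beta>) Leaf) (arr \<alpha> \<beta>, \<gamma>) Leaf"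
  define t where "t = Node Leaf (\<alpha>, arr \<beta> \<gamma>) (Node Leaf (\<beta>, \<gamma>) Leaf)"
  have "Poly_Mapping.single s 1 - Poly_Mapping.single t (1 :: 'k) =
      pcomp 1 (gen (arr \<alpha> \<beta>, \<gamma>)) (gen (\<alpha>, \<beta>)) - pcomp 2 (gen (\<alpha>, arr \<beta> \<gamma>)) (gen (\<beta>, \<gamma>))"
    by (simp add: s_def t_def gen_def pcomp_single)
  then have "Poly_Mapping.single s 1 - Poly_Mapping.single t (1 :: 'k) \<in> As2_relations arr"
    by (auto simp: As2_relations_def)
  moreover have "Poly_Mapping.single s 1 - Poly_Mapping.single t (1 :: 'k) \<in> free_arity 3"
    by (auto simp: free_arity_iff s_def t_def lookup_minus lookup_single when_def)
  ultimately have "operad_ideal (As2_relations arr) 3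
      (Poly_Mapping.single s 1 - Poly_Mapping.single t (1 :: 'k))"
    by (rule operad_ideal.rel)
  \<comment> \<open>The leaves are filled from right to left, so those still to be filled keep their
    positions.\<close>
  from ideal_graft_left[OF this, of 3 r]
  have "operad_ideal (As2_relations arr) (2 + size1 r)
      (Poly_Mapping.single (graft 3 s r) 1 - Poly_Mapping.single (graft 3 t r) (1 :: 'k))"
    by simp
  from ideal_graft_left[OF this, of 2 m]
  have "operad_ideal (As2_relations arr) (1 + size1 m + size1 r)
      (Poly_Mapping.single (graft 2 (graft 3 s r) m) 1
       - Poly_Mapping.single (graft 2 (graft 3 t r) m) (1 :: 'k))"
    by (simp add: add_ac)
  from ideal_graft_left[OF this, of 1 l]
  have "operad_ideal (As2_relations arr) (size1 l + size1 m + size1 r)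
      (Poly_Mapping.single (graft 1 (graft 2 (graft 3 s r) m) l) 1
       - Poly_Mapping.single (graft 1 (graft 2 (graft 3 t r) m) l) (1 :: 'k))"
    by (simp add: add_ac)
  then show ?case by (simp add: s_def t_def)
next
  case (left l l' a r)
  then have "operad_ideal (As2_relations arr) (size1 (Node Leaf a r) + size1 l - 1)
      (Poly_Mapping.single (graft 1 (Node Leaf a r) l) 1
       - Poly_Mapping.single (graft 1 (Node Leaf a r) l') (1 :: 'k))"
    by (intro ideal_graft_right) auto
  then show ?case by (simp add: add_ac)
next
  case (right r r' l a)
  then have "operad_ideal (As2_relations arr) (size1 (Node l a Leaf) + size1 r - 1)
      (Poly_Mapping.single (graft (size1 l + 1) (Node l a Leaf) r) 1
       - Poly_Mapping.single (graft (size1 l + 1) (Node l a Leaf) r') (1 :: 'k))"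
    by (intro ideal_graft_right) auto
  then show ?case by (simp add: add_ac)
qed

text \<open>The differences along a rewriting path telescope, and all steps have the same
  arity.\<close>

lemma nf_ideal:
  "operad_ideal (As2_relations arr) (size1 t)
     (Poly_Mapping.single t 1 - Poly_Mapping.single (nf arr t) (1 :: 'k::field))"
  using rewr_nf[of arr t]
proof (induction rule: rtranclp_induct)
  case base
  then show ?case by (simp add: operad_ideal.zero)
next
  case (step y z)
  from operad_ideal.add[OF step.IH] rewr_ideal[OF step.hyps(2)] rewr_rtranclp_size1[OF step.hyps(1)]
  show ?case by fastforce
qed

text \<open>Linear independence of the normal trees modulo the ideal: the functional detecting the
  normal form \<open>u\<close> kills the ideal, while on a combination of normal trees it reads off
  the coefficient of \<open>u\<close>.\<close>

lemma ideal_normal_trees: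
  fixes f :: "('w \<times> 'w) tree \<Rightarrow>\<^sub>0 'k::field"
  assumes "semigroup arr" "operad_ideal (As2_relations arr) n f"
    "Poly_Mapping.keys f \<subseteq> normal_trees arr n"
  shows "f = 0"
proof (intro poly_mapping_eqI)
  fix u
  show "Poly_Mapping.lookup f u = Poly_Mapping.lookup 0 u"
  proof (cases "u \<in> Poly_Mapping.keys f")
    case True
    define h :: "('w \<times> 'w) tree \<Rightarrow> 'k" where "h t = (if nf arr t = u then 1 else 0)" for t
    have nf: "nf arr t = t" if "t \<in> Poly_Mapping.keys f" for t
      using assms(3) that by (auto simp: normal_trees_def nf_normal_tree)
    have "linear_ext h f = 0"
      by (intro ideal_linear_ext[OF assms(1,2)]) (simp add: h_def nf_normal_tree normal_tree_nf)
    moreover have "linear_ext h f = (\<Sum>t\<in>Poly_Mapping.keys f. if t = u then Poly_Mapping.lookup f t else 0)"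
      unfolding linear_ext_def by (intro sum.cong) (auto simp: h_def nf)
    ultimately show ?thesis
      using True by simp
  qed (simp add: in_keys_iff)
qed

section \<open>Dimension\<close>

text \<open>The residue class of \<open>f\<close>. For \<open>f\<close> in
  \<open>free_arity n\<close> all its members have arity \<open>n\<close>, since the ideal component
  lies in \<open>free_arity n\<close>.\<close>

definition coset where
  "coset R n f = {g. operad_ideal R n (g - f)}"

lemma coset_eq_iff: "coset R n f = coset R n g \<longleftrightarrow> operad_ideal R n (f - g)"
proof
  assume "coset R n f = coset R n g"
  moreover have "f \<in> coset R n f" by (simp add: coset_def operad_ideal.zero)
  ultimately show "operad_ideal R n (f - g)" by (simp add: coset_def)
next
  assume fg: "operad_ideal R n (f - g)"
  have "operad_ideal R n (h - f) \<longleftrightarrow> operad_ideal R n (h - g)" for h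
    using operad_ideal.add[OF _ fg, of "h - f"] operad_ideal_diff[OF _ fg, of "h - g"] by auto
  then show "coset R n f = coset R n g" by (simp add: coset_def)
qed

section \<open>Vector space operations on residue classes\<close>

lemma a_r_coset_free_module: "{f. operad_ideal R n f} +>\<^bsub>free_module n\<^esub> f = coset R n f"
proof -
  have "g \<in> coset R n f \<longleftrightarrow> (\<exists>h. operad_ideal R n h \<and> g = h + f)" for g
    unfolding coset_def by (metis add_diff_cancel_right' diff_add_cancel mem_Collect_eq)
  then show ?thesis
    by (auto simp: a_r_coset_def' free_module_def)
qed

lemma carrier_presented_operad: "carrier (presented_operad R n) = coset R n ` free_arity n"
  unfolding presented_operad_def quotient_module_def
  by (auto simp: A_RCOSETS_def' a_r_coset_free_module) (auto simp: free_module_def)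

lemma zero_presented_operad: "\<zero>\<^bsub>presented_operad R n\<^esub> = coset R n 0"
  by (simp add: presented_operad_def quotient_module_def coset_def)

lemma add_presented_operad:
  "coset R n f \<oplus>\<^bsub>presented_operad R n\<^esub> coset R n g = coset R n (f + g)"
proof -
  have "(\<exists>f'\<in>coset R n f. \<exists>g'\<in>coset R n g. h = f' + g') \<longleftrightarrow> h \<in> coset R n (f + g)" for h
  proof
    assume "h \<in> coset R n (f + g)"
    then show "\<exists>f'\<in>coset R n f. \<exists>g'\<in>coset R n g. h = f' + g'"
      by (intro bexI[of _ "h - g"] bexI[of _ g])
         (auto simp: coset_def operad_ideal.zero algebra_simps)
  next
    assume "\<exists>f'\<in>coset R n f. \<exists>g'\<in>coset R n g. h = f' + g'"
    then obtain f' g' where "operad_ideal R n (f' - f)" "operad_ideal R n (g' - g)" "h = f' + g'"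
      by (auto simp: coset_def)
    then show "h \<in> coset R n (f + g)"
      using operad_ideal.add[of R n "f' - f" "g' - g"] by (simp add: coset_def algebra_simps)
  qed
  then show ?thesis
    by (auto simp: presented_operad_def quotient_module_def set_add_def' free_module_def)
qed

lemma smult_presented_operad:
  fixes c :: "'k::field"
  shows "c \<odot>\<^bsub>presented_operad R n\<^esub> coset R n f = coset R n (scale c f)"
proof -
  \<comment> \<open>The scalar multiple is a union over representatives; it collapses because they
    all give the same class and the index set contains \<open>f\<close>.\<close>
  have "coset R n (scale c g) = coset R n (scale c f)" if "g \<in> coset R n f" for g
  proof -
    have "scale c g - scale c f = scale c (g - f)"
      by (intro poly_mapping_eqI) (simp add: lookup_minus algebra_simps)
    moreover have "operad_ideal R n (scale c (g - f))"
      using that by (auto simp: coset_def intro: operad_ideal.scale)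
    ultimately show ?thesis by (simp only: coset_eq_iff)
  qed
  moreover have "f \<in> coset R n f" by (simp add: coset_def operad_ideal.zero)
  moreover have "c \<odot>\<^bsub>presented_operad R n\<^esub> coset R n f = (\<Union>g\<in>coset R n f. coset R n (scale c g))"
    by (simp add: presented_operad_def quotient_module_def a_r_coset_free_module)
       (simp add: free_module_def)
  ultimately show ?thesis by blast
qed

text \<open>The classes of the trees in \<open>T\<close> form a basis: \<open>spanning\<close> gives
  every tree the class of a tree in \<open>T\<close>, and \<open>indep\<close> gives linear
  independence. Stating this for arbitrary \<open>R\<close> separates the linear algebra from the
  rewriting.\<close>

lemma dim_presented_operad:
  fixes R :: "('g tree \<Rightarrow>\<^sub>0 'k::field) set"
  assumes finT: "finite T" and size1: "\<And>t. t \<in> T \<Longrightarrow> size1 t = n"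
    and indep: "\<And>f. operad_ideal R n f \<Longrightarrow> Poly_Mapping.keys f \<subseteq> T \<Longrightarrow> f = 0"
    and spanning: "\<And>t. size1 t = n \<Longrightarrow>
      \<exists>u\<in>T. operad_ideal R n (Poly_Mapping.single t 1 - Poly_Mapping.single u 1)"
  shows "vectorspace.fin_dim class_ring (presented_operad R n)"
    and "vectorspace.dim class_ring (presented_operad R n) = card T"
proof -
  let ?Q = "presented_operad R n"
  interpret vectorspace class_ring ?Q by (rule vectorspace_presented_operad)
  define b where "b t = coset R n (Poly_Mapping.single t 1)" for t
  have car_single: "coset R n (Poly_Mapping.single t c) \<in> carrier ?Q" if "size1 t = n" for t c
    unfolding carrier_presented_operad using that by (intro imageI single_free_arity)
  then have car: "b t \<in> carrier ?Q" if "size1 t = n" for t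
    unfolding b_def using that .
  have smult_b: "c \<odot>\<^bsub>?Q\<^esub> b t = coset R n (Poly_Mapping.single t c)" for c t
    unfolding b_def smult_presented_operad
    by (intro arg_cong[of _ _ "coset R n"] poly_mapping_eqI) (simp add: lookup_single when_def)
  have sum_b: "(\<Oplus>\<^bsub>?Q\<^esub>t\<in>S. a t \<odot>\<^bsub>?Q\<^esub> b t)
      = coset R n (\<Sum>t\<in>S. Poly_Mapping.single t (a t))" if "S \<subseteq> T" for a S
    using rev_finite_subset[OF finT that] that
  proof (induction S rule: finite_induct)
    case (insert t S)
    then show ?case
      by (subst finsum_insert) (auto simp: smult_b add_presented_operad size1 intro!: car_single)
  qed (simp add: zero_presented_operad)
  have inj: "inj_on b T"
  proof
    fix t u assume "t \<in> T" "u \<in> T" "b t = b u"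
    then have "Poly_Mapping.single t 1 - Poly_Mapping.single u (1 :: 'k) = 0"
      by (intro indep) (auto simp: b_def coset_eq_iff dest!: keys_diff[THEN subsetD])
    then have "Poly_Mapping.lookup (Poly_Mapping.single t 1) t = Poly_Mapping.lookup (Poly_Mapping.single u (1 :: 'k)) t"
      by simp
    then show "t = u" by (simp add: lookup_single when_def split: if_splits)
  qed
  have bT: "b ` T \<subseteq> carrier ?Q"
    using car size1 by auto
  have li: "lin_indpt (b ` T)"
  proof (rule finite_lin_indpt2)
    fix a assume "lincomb a (b ` T) = \<zero>\<^bsub>?Q\<^esub>"
    moreover have "lincomb a (b ` T) = (\<Oplus>\<^bsub>?Q\<^esub>t\<in>T. a (b t) \<odot>\<^bsub>?Q\<^esub> b t)"
      unfolding lincomb_def by (intro finsum_reindex inj) (auto simp: car size1)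
    moreover define f where "f = (\<Sum>t\<in>T. Poly_Mapping.single t (a (b t)))"
    ultimately have "operad_ideal R n f"
      using coset_eq_iff[of R n f 0] by (simp add: sum_b zero_presented_operad)
    moreover have lookup: "Poly_Mapping.lookup f t = (if t \<in> T then a (b t) else 0)" for t
      by (simp add: f_def lookup_sum lookup_single when_def finT)
    then have "Poly_Mapping.keys f \<subseteq> T"
      by (auto simp: in_keys_iff split: if_splits)
    ultimately have "f = 0" by (rule indep)
    then show "\<forall>v\<in>b ` T. a v = \<zero>\<^bsub>class_ring\<^esub>"
    proof (intro ballI)
      fix v assume "v \<in> b ` T"
      then obtain t where "t \<in> T" "v = b t" by auto
      with lookup[of t] \<open>f = 0\<close> show "a v = \<zero>\<^bsub>class_ring\<^esub>" by simp
    qed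
  qed (use finT bT in auto)
  interpret S: submodule class_ring "span (b ` T)" ?Q
    by (rule span_is_submodule[OF bT])
  \<comment> \<open>The set \<open>A\<close> ranges over all finite sets of trees of arity
    \<open>n\<close>, so that it can be the support of an arbitrary representative.\<close>
  have "coset R n (\<Sum>t\<in>A. Poly_Mapping.single t (c t)) \<in> span (b ` T)"
    if "finite A" "\<forall>t\<in>A. size1 t = n" for A and c :: "'g tree \<Rightarrow> 'k"
    using that
  proof (induction A rule: finite_induct)
    case empty
    then show ?case using S.zero_closed by (simp add: zero_presented_operad)
  next
    case (insert t A)
    from insert.prems spanning[of t] obtain u where u: "u \<in> T" "b t = b u"
      by (auto simp: b_def coset_eq_iff)
    then have "b t \<in> span (b ` T)"
      using in_own_span[OF bT] by auto
    then have "coset R n (Poly_Mapping.single t (c t)) \<in> span (b ` T)"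
      using S.smult_closed[of "c t" "b t"] by (simp add: smult_b)
    with insert show ?case
      using S.m_closed by (simp add: add_presented_operad[symmetric])
  qed
  note span_b = this
  have "carrier ?Q \<subseteq> span (b ` T)"
  proof
    fix X assume "X \<in> carrier ?Q"
    then obtain f where f: "f \<in> free_arity n" "X = coset R n f"
      by (auto simp: carrier_presented_operad)
    have "f = (\<Sum>t\<in>Poly_Mapping.keys f. Poly_Mapping.single t (Poly_Mapping.lookup f t))"
      by (intro poly_mapping_eqI) (simp add: lookup_sum lookup_single when_def in_keys_iff)
    with span_b[of "Poly_Mapping.keys f" "Poly_Mapping.lookup f"] f
    show "X \<in> span (b ` T)" by (simp add: free_arity_def)
  qed
  then have gen: "gen_set (b ` T)"
    using span_is_subset2[OF bT] by blast
  then show "fin_dim"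
    unfolding fin_dim_def using finT bT by blast
  have "dim = card (b ` T)"
    using finT li bT gen by (intro dim_basis) (auto simp: basis_def)
  then show "dim = card T"
    by (simp add: card_image inj)
qed

lemma dim_As2:
  fixes arr :: "'w::finite \<Rightarrow> 'w \<Rightarrow> 'w"
  assumes "semigroup arr"
  shows "vectorspace.fin_dim class_ring (As2 arr n :: ('k::field, (('w \<times> 'w) tree \<Rightarrow>\<^sub>0 'k) set) module)"
    and "int (vectorspace.dim class_ring
            (As2 arr n :: ('k, (('w \<times> 'w) tree \<Rightarrow>\<^sub>0 'k) set) module))
         = poly (As2_poly n) (int CARD('w))"
proof -
  have 1: "size1 t = n" if "t \<in> normal_trees arr n" for t
    using that by (simp add: normal_trees_def)
  have 2: "f = 0" if "operad_ideal (As2_relations arr) n f" "Poly_Mapping.keys f \<subseteq> normal_trees arr n"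
    for f :: "('w \<times> 'w) tree \<Rightarrow>\<^sub>0 'k"
    using ideal_normal_trees[OF assms that] .
  have 3: "\<exists>u\<in>normal_trees arr n. operad_ideal (As2_relations arr) n
      (Poly_Mapping.single t 1 - Poly_Mapping.single u (1 :: 'k))" if "size1 t = n" for t
    using that nf_ideal[of arr t] rewr_rtranclp_size1[OF rewr_nf[of arr t]]
    by (intro bexI[of _ "nf arr t"]) (auto simp: normal_trees_def normal_tree_nf)
  have "vectorspace.fin_dim class_ring (As2 arr n :: ('k, (('w \<times> 'w) tree \<Rightarrow>\<^sub>0 'k) set) module)"
    and "vectorspace.dim class_ring (As2 arr n :: ('k, (('w \<times> 'w) tree \<Rightarrow>\<^sub>0 'k) set) module)
      = card (normal_trees arr n)"
    unfolding As2_def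
    by (rule dim_presented_operad[where T = "normal_trees arr n"]; fact finite_normal_trees 1 2 3)+
  then show "vectorspace.fin_dim class_ring (As2 arr n :: ('k, (('w \<times> 'w) tree \<Rightarrow>\<^sub>0 'k) set) module)"
    and "int (vectorspace.dim class_ring
            (As2 arr n :: ('k, (('w \<times> 'w) tree \<Rightarrow>\<^sub>0 'k) set) module))
         = poly (As2_poly n) (int CARD('w))"
    by (simp_all add: card_normal_trees)
qed

section \<open>The polynomials\<close>

lemma degree_As2_poly_le: "degree (As2_poly n) \<le> 2 * n - 2"
proof (induction n rule: less_induct)
  case (less n)
  show ?case
  proof (cases "n \<ge> 2")
    case True
    \<comment> \<open>By induction the bound is (2k - 2) + (2(n - k) - 2) = 2n - 4; the prefactor
      X(X - 1) adds 2.\<close>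
    have "degree (As2_poly k * As2_poly (n - k)) \<le> 2 * n - 4" if "k \<in> {1..n - 1}" for k
      using degree_mult_le[of "As2_poly k" "As2_poly (n - k)"] less[of k] less[of "n - k"] that
      by force
    then have 1: "degree (\<Sum>k = 1..n - 1. As2_poly k * As2_poly (n - k)) \<le> 2 * n - 4" (is "degree ?S \<le> _")
      by (intro degree_sum_le) auto
    have "degree ([:0, 1:] * ([:0, 1:] - 1) :: int poly) \<le> 2"
      by (simp add: one_pCons)
    with 1 have "degree ([:0, 1:] * ([:0, 1:] - 1) * ?S) \<le> 2 * n - 2"
      using degree_mult_le[of "[:0, 1:] * ([:0, 1:] - 1)" ?S] True by linarith
    moreover have "degree ([:0, 1:] * As2_poly (n - 1)) \<le> 2 * n - 2"
      using degree_mult_le[of "[:0, 1:]" "As2_poly (n - 1)"] less[of "n - 1"] True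
      by (simp add: degree_pCons_eq_if)
    ultimately show ?thesis
      unfolding As2_poly_rec[OF True] by (rule degree_add_le)
  next
    case False
    then have "n = 0 \<or> n = Suc 0" by linarith
    then show ?thesis by (auto simp: As2_poly_0 As2_poly_1)
  qed
qed

text \<open>Only degree bounds are assumed, so the formula applies before the exact degrees are
  known.\<close>

lemma coeff_mult_degree_le:
  assumes "degree p \<le> m" "degree q \<le> n"
  shows "coeff (p * q) (m + n) = coeff p m * coeff q n"
proof -
  have "coeff (p * q) (m + n) = (\<Sum>i\<le>m + n. coeff p i * coeff q (m + n - i))"
    by (rule coeff_mult)
  also have "\<dots> = (\<Sum>i\<in>{m}. coeff p i * coeff q (m + n - i))"
  proof (rule sum.mono_neutral_right)
    show "\<forall>i\<in>{..m + n} - {m}. coeff p i * coeff q (m + n - i) = 0"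
    proof
      fix i assume "i \<in> {..m + n} - {m}"
      then have "i > m \<or> m + n - i > n" by auto
      then show "coeff p i * coeff q (m + n - i) = 0"
        using assms coeff_eq_0[of p i] coeff_eq_0[of q "m + n - i"] by auto
    qed
  qed auto
  finally show ?thesis by simp
qed

text \<open>The coefficient in the expected top degree; that it is the leading one follows once it
  is known to be positive. The index is shifted: \<open>catalan n\<close> counts planar binary trees
  with \<open>n\<close> leaves.\<close>

definition catalan :: "nat \<Rightarrow> int" where
  "catalan n = coeff (As2_poly n) (2 * n - 2)"

lemma catalan_0: "catalan 0 = 0" and catalan_1: "catalan (Suc 0) = 1"
  by (simp_all add: catalan_def As2_poly_0 As2_poly_1)

text \<open>With \<open>S\<close> of degree at most 2n - 4, only X^2 S reaches degree 2n - 2 in the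
  recursion; X S and X times the previous polynomial stop at 2n - 3.\<close>

lemma catalan_rec:
  assumes "n \<ge> 2"
  shows "catalan n = (\<Sum>k = 1..n - 1. catalan k * catalan (n - k))"
proof -
  define S where "S = (\<Sum>k = 1..n - 1. As2_poly k * As2_poly (n - k))"
  have n: "2 * n - 2 = Suc (Suc (2 * n - 4))" using assms by simp
  have "degree (As2_poly k * As2_poly (n - k)) \<le> 2 * n - 4" if "k \<in> {1..n - 1}" for k
    using degree_mult_le[of "As2_poly k" "As2_poly (n - k)"] that
      degree_As2_poly_le[of k] degree_As2_poly_le[of "n - k"]
    by auto
  then have "degree S \<le> 2 * n - 4"
    unfolding S_def by (intro degree_sum_le) auto
  then have S1: "coeff S (Suc (2 * n - 4)) = 0"
    by (intro coeff_eq_0) auto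
  have P1: "coeff (As2_poly (n - 1)) (Suc (2 * n - 4)) = 0"
    using degree_As2_poly_le[of "n - 1"] assms by (intro coeff_eq_0) linarith
  have "As2_poly n = pCons 0 (pCons 0 S) - pCons 0 S + pCons 0 (As2_poly (n - 1))"
    using As2_poly_rec[OF assms] by (simp add: S_def algebra_simps)
  then have "catalan n = coeff S (2 * n - 4)"
    unfolding catalan_def n using P1 by (simp add: S1)
  also have "\<dots> = (\<Sum>k = 1..n - 1. catalan k * catalan (n - k))"
    unfolding S_def coeff_sum
  proof (rule sum.cong)
    fix k assume "k \<in> {1..n - 1}"
    then have "2 * n - 4 = (2 * k - 2) + (2 * (n - k) - 2)" by auto
    then show "coeff (As2_poly k * As2_poly (n - k)) (2 * n - 4) = catalan k * catalan (n - k)"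
      unfolding catalan_def
      using coeff_mult_degree_le[OF degree_As2_poly_le degree_As2_poly_le, of k "n - k"] by simp
  qed simp
  finally show ?thesis .
qed

text \<open>The generating series \<open>C\<close> of the Catalan numbers satisfies \<open>C = X + C\<^sup>2\<close>, so that
  \<open>D = 1 - 2 C\<close> satisfies \<open>D\<^sup>2 = 1 - 4 X\<close>, hence \<open>(1 - 4 X) D' = - 2 D\<close>.\<close>

lemma catalan_Suc:
  assumes "n \<ge> 1"
  shows "int (Suc n) * catalan (Suc n) = (4 * int n - 2) * catalan n"
proof -
  define C :: "int fps" where "C = Abs_fps catalan"
  define D where "D = 1 - 2 * C"
  have "C = fps_X + C\<^sup>2"
  proof (rule fps_ext)
    fix n :: nat
    consider "n = (0::nat)" | "n = 1" | "n \<ge> 2" by linarith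
    then show "fps_nth C n = fps_nth (fps_X + C\<^sup>2) n"
    proof cases
      case 3
      have "fps_nth (C\<^sup>2) n = (\<Sum>k = 0..n. catalan k * catalan (n - k))"
        by (simp add: power2_eq_square fps_mult_nth C_def)
      also have "\<dots> = (\<Sum>k = 1..n - 1. catalan k * catalan (n - k))"
      proof (rule sum.mono_neutral_right)
        show "\<forall>i\<in>{0..n} - {1..n - 1}. catalan i * catalan (n - i) = 0"
        proof
          fix i assume "i \<in> {0..n} - {1..n - 1}"
          then have "i = 0 \<or> i = n" by auto
          then show "catalan i * catalan (n - i) = 0" by (auto simp: catalan_0)
        qed
      qed auto
      finally show ?thesis
        using 3 by (simp add: C_def catalan_rec fps_X_def)
    qed (simp_all add: C_def power2_eq_square fps_mult_nth catalan_0 catalan_1)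
  qed
  then have "fps_X = C - C\<^sup>2"
    by (metis add_diff_cancel_right')
  moreover have "D * D = 1 - 4 * (C - C\<^sup>2)"
    by (simp add: D_def power2_eq_square algebra_simps)
  ultimately have D2: "D * D = 1 - 4 * fps_X"
    by (simp only:)
  have "fps_deriv (D * D) = - 4"
    unfolding D2 by simp
  then have "2 * (D * fps_deriv D) = - 4"
    by (simp add: algebra_simps)
  \<comment> \<open>Division is avoided: the wanted equation times 2 and \<open>D\<close> vanishes,
    and both factors cancel because integer power series form an integral domain.\<close>
  moreover have "D * (2 * (D * D * fps_deriv D + 2 * D))
      = D * D * (2 * (D * fps_deriv D)) + 4 * (D * D)"
    by (simp add: algebra_simps)
  ultimately have "D * (2 * (D * D * fps_deriv D + 2 * D)) = 0"
    by (simp only:) simp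
  moreover have "D \<noteq> 0"
  proof -
    have "fps_nth (D * D) 0 = 1" unfolding D2 by simp
    then show ?thesis by auto
  qed
  ultimately have "(1 - 4 * fps_X) * fps_deriv D + 2 * D = 0"
    unfolding D2 by (metis mult_eq_0_iff zero_neq_numeral)
  \<comment> \<open>With d_k the coefficients of \<open>D\<close>, this reads (n + 1) d_{n+1} - 4 n
    d_n + 2 d_n = 0. Since n \<ge> 1, the exceptional constant term of \<open>D\<close> does not
    occur.\<close>
  then have "fps_nth ((1 - 4 * fps_X) * fps_deriv D + 2 * D) n = 0"
    by simp
  moreover have "fps_nth D k = (if k = 0 then 1 else 0) - 2 * catalan k" for k
    by (simp add: D_def C_def numeral_fps_const)
  ultimately show ?thesis
    using assms by (simp add: left_diff_distrib mult.assoc numeral_fps_const algebra_simps)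
qed

text \<open>Both sides satisfy (n + 1) x_{n+1} = (4n + 2) x_n with x_0 = 1: the left by
  \<open>catalan_Suc\<close>, the central binomial coefficients by the absorption
  identities.\<close>

lemma catalan_closed_form: "int (Suc n) * catalan (Suc n) = int (2 * n choose n)"
proof (induction n)
  case 0
  then show ?case by (simp add: catalan_1)
next
  case (Suc n)
  have "int (Suc n) * (int (Suc (Suc n)) * catalan (Suc (Suc n)))
      = (4 * int n + 2) * (int (Suc n) * catalan (Suc n))"
    by (subst catalan_Suc) (simp_all add: algebra_simps)
  also have "\<dots> = (4 * int n + 2) * int (2 * n choose n)"
    by (simp only: Suc)
  also have "\<dots> = int (Suc n) * int (2 * Suc n choose Suc n)"
  proof -
    have "Suc n * (2 * Suc n choose Suc n) = (2 * Suc n) * (Suc (2 * n) choose n)"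
      using Suc_times_binomial_eq[of "Suc (2 * n)" n] by simp
    moreover have "Suc n * (Suc (2 * n) choose n) = Suc (2 * n) * (2 * n choose n)"
      using binomial_absorb_comp[of "Suc (2 * n)" n] by simp
    ultimately have "Suc n * (2 * Suc n choose Suc n) = 2 * (Suc (2 * n) * (2 * n choose n))"
      by (metis mult.assoc)
    then have "Suc n * (2 * Suc n choose Suc n) = (4 * n + 2) * (2 * n choose n)"
      by (simp add: algebra_simps del: binomial_Suc_Suc)
    then have "int (Suc n * (2 * Suc n choose Suc n)) = int ((4 * n + 2) * (2 * n choose n))"
      by (simp only:)
    then show ?thesis by (simp only: of_nat_mult of_nat_add of_nat_numeral)
  qed
  finally show ?case by simp
qed

lemma catalan_pos: "n \<ge> 1 \<Longrightarrow> catalan n > 0"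
proof -
  assume "n \<ge> 1"
  then obtain m where "n = Suc m" by (cases n) auto
  moreover have "int (Suc m) * catalan (Suc m) > 0"
    unfolding catalan_closed_form by simp
  ultimately show ?thesis
    by (simp add: zero_less_mult_iff)
qed

text \<open>The upper bound is attained because the coefficient there is positive.\<close>

lemma degree_As2_poly: "n \<ge> 1 \<Longrightarrow> degree (As2_poly n) = 2 * n - 2"
  using catalan_pos[of n] degree_As2_poly_le[of n] le_degree[of "As2_poly n" "2 * n - 2"]
  by (simp add: catalan_def)

lemma lead_coeff_As2_poly:
  assumes "n \<ge> 1"
  shows "(of_int (lead_coeff (As2_poly n)) :: rat) =
    1 / of_nat n * of_nat ((2 * n - 2) choose (n - 1))"
proof -
  obtain m where n: "n = Suc m" using assms by (cases n) auto
  have "lead_coeff (As2_poly n) = catalan n"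
    unfolding catalan_def degree_As2_poly[OF assms] ..
  moreover have "(of_int (int (Suc m) * catalan (Suc m)) :: rat) = of_nat (2 * m choose m)"
    unfolding catalan_closed_form by simp
  ultimately show ?thesis
    unfolding n by (simp add: field_simps del: of_nat_Suc)
qed

text \<open>The boundary indices 1 and n - 1 contribute 2 p_{n-1}, which has only the factor
  X^(n-1); the outer X supplies the missing one. Inner products carry X^k X^(n-k) = X^n and a
  further outer X, so they vanish at 0 in the quotient, leaving q_n(0) = -2 q_{n-1}(0) +
  q_{n-1}(0).\<close>

lemma As2_poly_factor:
  assumes "n \<ge> 2"
  shows "\<exists>q. As2_poly n = [:0, 1:] ^ n * q \<and> poly q 0 = (- 1) ^ n"
  using assms
proof (induction n rule: less_induct)
  case (less n)
  let ?X = "[:0, 1:] :: int poly"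
  show ?case
  proof (cases "n = 2")
    \<comment> \<open>Here the two boundary indices coincide, and X(X - 1) + X = X^2.\<close>
    case True
    have "As2_poly 2 = ?X ^ 2 * 1"
      by (simp add: As2_poly_rec As2_poly_1 power2_eq_square)
    then show ?thesis unfolding True by (intro exI[of _ 1]) simp
  next
    case False
    with less.prems have n: "n \<ge> 3" by simp
    have "\<forall>k. \<exists>q. 2 \<le> k \<and> k < n \<longrightarrow> As2_poly k = ?X ^ k * q \<and> poly q 0 = (- 1) ^ k"
      using less.IH by blast
    then obtain q where q: "2 \<le> k \<Longrightarrow> k < n \<Longrightarrow> As2_poly k = ?X ^ k * q k"
        and q0: "2 \<le> k \<Longrightarrow> k < n \<Longrightarrow> poly (q k) 0 = (- 1) ^ k" for k
      by metis
    define r where "r = (\<Sum>k = 2..n - 2. q k * q (n - k))"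
    have "{1..n - 1} = insert 1 (insert (n - 1) {2..n - 2})"
      using n by auto
    moreover have "n - 1 \<noteq> 1" "n - 1 \<notin> {2..n - 2}" "1 \<notin> {2..n - 2}"
      using n by auto
    ultimately have "(\<Sum>k = 1..n - 1. As2_poly k * As2_poly (n - k))
        = 2 * As2_poly (n - 1) + (\<Sum>k = 2..n - 2. As2_poly k * As2_poly (n - k))"
      using n by (simp del: One_nat_def add: As2_poly_1[folded One_nat_def])
    also have "(\<Sum>k = 2..n - 2. As2_poly k * As2_poly (n - k)) = ?X ^ n * r"
      unfolding r_def sum_distrib_left
    proof (rule sum.cong)
      fix k assume k: "k \<in> {2..n - 2}"
      then have *: "2 \<le> k" "k < n" "2 \<le> n - k" "n - k < n"
        using n by auto
      from k have "?X ^ n = ?X ^ k * ?X ^ (n - k)"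
        by (auto simp flip: power_add)
      then show "As2_poly k * As2_poly (n - k) = ?X ^ n * (q k * q (n - k))"
        by (simp add: q * mult_ac)
    qed simp
    finally have sum: "(\<Sum>k = 1..n - 1. As2_poly k * As2_poly (n - k))
        = 2 * As2_poly (n - 1) + ?X ^ n * r" .
    have q1: "As2_poly (n - 1) = ?X ^ (n - 1) * q (n - 1)"
      using n by (intro q) auto
    have X: "?X ^ n = ?X * ?X ^ (n - 1)"
      using n by (simp flip: power_Suc)
    have "As2_poly n = ?X * (?X - 1) * (2 * As2_poly (n - 1) + ?X ^ n * r) + ?X * As2_poly (n - 1)"
      using As2_poly_rec[OF less.prems] sum by simp
    also have "\<dots> = ?X ^ n * ((?X - 1) * (2 * q (n - 1) + ?X * r) + q (n - 1))"
      unfolding q1 X by (simp only: algebra_simps)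
    finally have "As2_poly n = ?X ^ n * ((?X - 1) * (2 * q (n - 1) + ?X * r) + q (n - 1))" .
    moreover have "poly ((?X - 1) * (2 * q (n - 1) + ?X * r) + q (n - 1)) 0 = (- 1) ^ n"
      using n q0[of "n - 1"] by (simp add: power_eq_if[of _ n])
    ultimately show ?thesis by blast
  qed
qed

text \<open>At 1/2 the factor \<omega>(\<omega> - 1) is -1/4, so the boundary terms give -1/2
  v_{n-1} and cancel the linear term. In each remaining product one of k and n - k is odd and at
  least 3, hence that factor vanishes by induction.\<close>

lemma As2_poly_half:
  assumes "odd n" "n \<ge> 3"
  shows "poly (map_poly of_int (As2_poly n) :: rat poly) (1 / 2) = 0"
proof -
  define v where "v n = poly (map_poly of_int (As2_poly n) :: rat poly) (1 / 2)" for n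
  have v1: "v (Suc 0) = 1"
    by (simp add: v_def As2_poly_1)
  have v_rec: "v n = - 1 / 4 * (\<Sum>k = 1..n - 1. v k * v (n - k)) + 1 / 2 * v (n - 1)"
    if "n \<ge> 2" for n
    unfolding v_def As2_poly_rec[OF that]
    by (simp only: of_int_poly_hom.hom_mult of_int_poly_hom.hom_add of_int_poly_hom.hom_minus
        of_int_poly_hom.hom_sum of_int_poly_hom.hom_one poly_sum poly_mult poly_add poly_diff)
       (simp add: map_poly_pCons)
  have "v n = 0"
    using assms
  proof (induction n rule: less_induct)
    case (less n)
    then have "{1..n - 1} = insert 1 (insert (n - 1) {2..n - 2})"
      by auto
    moreover have "n - 1 \<noteq> 1" "n - 1 \<notin> {2..n - 2}" "1 \<notin> {2..n - 2}"
      using less.prems by auto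
    ultimately have "(\<Sum>k = 1..n - 1. v k * v (n - k))
        = 2 * v (n - 1) + (\<Sum>k = 2..n - 2. v k * v (n - k))"
      using less.prems by (simp del: One_nat_def add: v1[folded One_nat_def])
    also have "(\<Sum>k = 2..n - 2. v k * v (n - k)) = 0"
    proof (rule sum.neutral, rule ballI)
      fix k assume k: "k \<in> {2..n - 2}"
      have "v k = 0 \<or> v (n - k) = 0"
      proof (cases "odd k")
        case True
        with k have "k \<noteq> 2" by auto
        then show ?thesis using True k by (intro disjI1 less.IH) auto
      next
        case False
        with less.prems k have "odd (n - k)" by auto
        moreover from this k have "n - k \<noteq> 2" by (metis even_numeral)
        ultimately show ?thesis using k by (intro disjI2 less.IH) auto
      qed
      then show "v k * v (n - k) = 0" by auto
    qed
    finally show ?case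
      using v_rec[of n] less.prems by simp
  qed
  then show ?thesis by (simp add: v_def)
qed

theorem corollary1p4:
  shows "\<forall>n\<ge>1.
    (\<forall>arr :: 'w::finite \<Rightarrow> 'w \<Rightarrow> 'w. semigroup arr \<longrightarrow>
       vectorspace.fin_dim class_ring (As2 arr n :: ('k::field, (('w \<times> 'w) tree \<Rightarrow>\<^sub>0 'k) set) module)
     \<and> int (vectorspace.dim class_ring
              (As2 arr n :: ('k, (('w \<times> 'w) tree \<Rightarrow>\<^sub>0 'k) set) module))
       = poly (As2_poly n) (int CARD('w)))
    \<and> degree (As2_poly n) = 2 * n - 2
    \<and> (of_int (lead_coeff (As2_poly n)) :: rat) = 1 / of_nat n * of_nat ((2 * n - 2) choose (n - 1))
    \<and> (n \<ge> 2 \<longrightarrow> (\<exists>q :: int poly. As2_poly n = [:0, 1:] ^ n * q \<and> poly q 0 = (- 1) ^ n))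
    \<and> (odd n \<and> n \<ge> 3 \<longrightarrow> poly (map_poly of_int (As2_poly n) :: rat poly) (1 / 2) = 0)"
  using dim_As2 degree_As2_poly lead_coeff_As2_poly As2_poly_factor As2_poly_half by blast

end
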